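(* Let $p\in\mathbb{R}$ and $q\geqslant 0$. Let $\sigma$ be a (non-zero) $(p,q)$-harmonic vector field on the round unit sphere $\mathbb{S}^2$ of the form $\sigma=\nabla f$, where $f$ is a smooth function on $\mathbb{S}^2$ with $\Delta f=\lambda f$ for some constant $\lambda\in\mathbb{R}$. If $U\subset\mathbb{S}^2$ is an open subset on which $\nabla_\sigma\sigma$ and $\sigma$ are non-colinear (i.e. linearly independent at each point of $U$), then $\Delta\tfrac{|\sigma|^2}{2}\leqslant 0$ on $U$.
   Context: $\nabla f$ denotes the gradient of $f$, and $\nabla$ also denotes the Levi-Civita connection. A vector field $\sigma$ on a Riemannian manifold $(M,g)$ is called $(p,q)$-harmonic if $$(1+|\sigma|^2)\nabla^*\nabla\sigma+2p\,\nabla_{X(\sigma)}\sigma=\Big[p|\nabla\sigma|^2-pq|X(\sigma)|^2-q(1+|\sigma|^2)\Delta\big(\tfrac{|\sigma|^2}{2}\big)\Big]\sigma ,$$ where $\nabla^*\nabla\sigma=-\operatorname{trace}(\nabla^2\sigma)$, $\Delta=-\operatorname{div}\nabla$ is the Laplacian on functions (non-negative spectrum), $X(\sigma)=\nabla\big(\tfrac{|\sigma|^2}{2}\big)$ is the gradient of $|\sigma|^2/2$, and $|\nabla\sigma|^2=\sum_i|\nabla_{e_i}\sigma|^2$ for a local orthonormal frame $\{e_i\}$. *)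

theory Defs
  imports "HOL-Analysis.Analysis"
begin

abbreviation S2 :: "(real^3) set"
  where "S2 \<equiv> sphere 0 1"

definition tangent_plane :: "real^3 \<Rightarrow> (real^3) set"
  where "tangent_plane x = {v. x \<bullet> v = 0}"

text \<open>Orthogonal projection onto the tangent plane, for a unit vector \<open>x\<close>.\<close>

definition tproj :: "real^3 \<Rightarrow> real^3 \<Rightarrow> real^3"
  where "tproj x w = w - (x \<bullet> w) *\<^sub>R x"


subsection \<open>Smooth maps on the sphere\<close>

text \<open>For open \<open>V\<close> in a Euclidean space this is the class \<open>C\<^sup>k\<close>: all iterated directional
  derivatives up to order \<open>k\<close> exist, as values of Frechet derivatives, and are continuous.\<close>

primrec Ck_on :: "nat \<Rightarrow> 'a::real_normed_vector set \<Rightarrow> ('a \<Rightarrow> 'b::real_normed_vector) \<Rightarrow> bool"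
  where
    "Ck_on 0 V F \<longleftrightarrow> continuous_on V F"
  | "Ck_on (Suc k) V F \<longleftrightarrow>
       (\<forall>x\<in>V. F differentiable (at x)) \<and>
       (\<forall>v. Ck_on k V (\<lambda>x. frechet_derivative F (at x) v))"

definition smooth_on :: "'a::real_normed_vector set \<Rightarrow> ('a \<Rightarrow> 'b::real_normed_vector) \<Rightarrow> bool"
  where "smooth_on V F \<longleftrightarrow> (\<forall>k. Ck_on k V F)"

text \<open>Functions and fields on the sphere are represented by functions on the whole of
  \<open>\<real>\<^sup>3\<close>; only their values on the sphere matter.  Such a map is smooth if
  it has smooth local extensions to open sets of the ambient space.\<close>

definition smooth_S2 :: "(real^3 \<Rightarrow> 'b::real_normed_vector) \<Rightarrow> bool"
  where "smooth_S2 F \<longleftrightarrow>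
    (\<forall>x\<in>S2. \<exists>V G. open V \<and> x \<in> V \<and> smooth_on V G \<and> (\<forall>y\<in>V \<inter> S2. F y = G y))"

definition vector_field :: "(real^3 \<Rightarrow> real^3) \<Rightarrow> bool"
  where "vector_field X \<longleftrightarrow> smooth_S2 X \<and> (\<forall>x\<in>S2. X x \<in> tangent_plane x)"

text \<open>The derivative within the sphere is determined only on tangent vectors \<open>v\<close>
  (see \<open>differential_eqI\<close> below), and it is used only there.\<close>

definition differential :: "(real^3 \<Rightarrow> 'b::real_normed_vector) \<Rightarrow> real^3 \<Rightarrow> real^3 \<Rightarrow> 'b"
  where "differential F x v = frechet_derivative F (at x within S2) v"


subsection \<open>Riemannian notions for the round metric\<close>

text \<open>The Levi-Civita connection of the metric induced from \<open>\<real>\<^sup>3\<close>: the tangential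
  part of the ambient derivative.  It is shown below to be metric and torsion-free.\<close>

definition cov_deriv :: "(real^3 \<Rightarrow> real^3) \<Rightarrow> real^3 \<Rightarrow> real^3 \<Rightarrow> real^3"
  where "cov_deriv Y x v = tproj x (differential Y x v)"

definition nabla :: "(real^3 \<Rightarrow> real^3) \<Rightarrow> (real^3 \<Rightarrow> real^3) \<Rightarrow> real^3 \<Rightarrow> real^3"
  where "nabla X Y x = cov_deriv Y x (X x)"

definition nabla2 ::
    "(real^3 \<Rightarrow> real^3) \<Rightarrow> (real^3 \<Rightarrow> real^3) \<Rightarrow> (real^3 \<Rightarrow> real^3) \<Rightarrow> real^3 \<Rightarrow> real^3"
  where "nabla2 X Y \<sigma> x = nabla X (nabla Y \<sigma>) x - nabla (nabla X Y) \<sigma> x"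

definition is_frame :: "real^3 \<Rightarrow> (real^3) set \<Rightarrow> bool"
  where "is_frame x E \<longleftrightarrow>
    E \<subseteq> tangent_plane x \<and> pairwise orthogonal E \<and> (\<forall>e\<in>E. norm e = 1) \<and>
    span E = tangent_plane x"

definition frame :: "real^3 \<Rightarrow> (real^3) set"
  where "frame x = (SOME E. is_frame x E)"

definition grad :: "(real^3 \<Rightarrow> real) \<Rightarrow> real^3 \<Rightarrow> real^3"
  where "grad h x =
    (THE w. w \<in> tangent_plane x \<and> (\<forall>v\<in>tangent_plane x. w \<bullet> v = differential h x v))"

definition divergence :: "(real^3 \<Rightarrow> real^3) \<Rightarrow> real^3 \<Rightarrow> real"
  where "divergence X x = (\<Sum>e\<in>frame x. cov_deriv X x e \<bullet> e)"

definition laplacian :: "(real^3 \<Rightarrow> real) \<Rightarrow> real^3 \<Rightarrow> real"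
  where "laplacian h x = - divergence (grad h) x"

text \<open>The second covariant derivative is tensorial in its first two arguments, so the trace
  at \<open>x\<close> may be computed with any extension of a tangent vector \<open>e\<close> to a vector
  field; here \<open>\<lambda>y. tproj y e\<close>.\<close>

definition rough_laplacian :: "(real^3 \<Rightarrow> real^3) \<Rightarrow> real^3 \<Rightarrow> real^3"
  where "rough_laplacian \<sigma> x =
    - (\<Sum>e\<in>frame x. nabla2 (\<lambda>y. tproj y e) (\<lambda>y. tproj y e) \<sigma> x)"

definition norm_nabla_sq :: "(real^3 \<Rightarrow> real^3) \<Rightarrow> real^3 \<Rightarrow> real"
  where "norm_nabla_sq \<sigma> x = (\<Sum>e\<in>frame x. (norm (cov_deriv \<sigma> x e))\<^sup>2)"

definition half_norm_sq :: "(real^3 \<Rightarrow> real^3) \<Rightarrow> real^3 \<Rightarrow> real"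
  where "half_norm_sq \<sigma> y = (norm (\<sigma> y))\<^sup>2 / 2"

definition pq_harmonic :: "real \<Rightarrow> real \<Rightarrow> (real^3 \<Rightarrow> real^3) \<Rightarrow> bool"
  where "pq_harmonic p q \<sigma> \<longleftrightarrow> vector_field \<sigma> \<and>
    (\<forall>x\<in>S2.
      (1 + (norm (\<sigma> x))\<^sup>2) *\<^sub>R rough_laplacian \<sigma> x
        + (2 * p) *\<^sub>R nabla (grad (half_norm_sq \<sigma>)) \<sigma> x
      = (p * norm_nabla_sq \<sigma> x
         - p * q * (norm (grad (half_norm_sq \<sigma>) x))\<^sup>2
         - q * (1 + (norm (\<sigma> x))\<^sup>2) * laplacian (half_norm_sq \<sigma>) x) *\<^sub>R \<sigma> x)"


subsection \<open>The notions are well defined\<close>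

lemma sphere_curve:
  assumes x: "x \<in> S2" and v: "v \<in> tangent_plane x"
  obtains c :: "real \<Rightarrow> real^3"
  where "c 0 = x" "range c \<subseteq> S2" "(c has_vector_derivative v) (at 0)"
proof (cases "v = 0")
  case True
  show ?thesis by (rule that[of "\<lambda>_. x"]) (use x True in auto)
next
  case False
  define n where "n = norm v"
  have n: "n > 0" using False by (simp add: n_def)
  define c where "c = (\<lambda>t::real. cos (n * t) *\<^sub>R x + (sin (n * t) / n) *\<^sub>R v)"
  have xx: "x \<bullet> x = 1" using x by (simp add: dot_square_norm)
  have vv: "v \<bullet> v = n\<^sup>2" by (simp add: n_def dot_square_norm)
  have xv: "x \<bullet> v = 0" "v \<bullet> x = 0"
    using v by (auto simp: tangent_plane_def inner_commute)
  have "c t \<bullet> c t = (cos (n * t))\<^sup>2 + (sin (n * t))\<^sup>2" for t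
    using n by (simp add: c_def inner_add_left inner_add_right xx vv xv power2_eq_square)
  then have "c t \<bullet> c t = 1" for t by simp
  then have "norm (c t) = 1" for t by (simp add: norm_eq_sqrt_inner)
  then have "range c \<subseteq> S2" by auto
  moreover have "c 0 = x" by (simp add: c_def)
  moreover have "(c has_vector_derivative v) (at 0)"
    unfolding c_def by (auto intro!: derivative_eq_intros simp: n less_imp_neq[OF n, symmetric])
  ultimately show ?thesis using that by blast
qed

lemma has_derivative_within_S2_curve:
  assumes F: "(F has_derivative D) (at x within S2)"
    and c: "c 0 = x" "range c \<subseteq> S2" "(c has_vector_derivative v) (at 0)"
  shows "((F \<circ> c) has_vector_derivative D v) (at 0)"
proof -
  have "(F has_derivative D) (at (c 0) within c ` UNIV)"
    using has_derivative_subset[OF F c(2)] c(1) by simp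
  from diff_chain_within[OF c(3)[unfolded has_vector_derivative_def] this]
  show ?thesis
    using linear_scale[OF has_derivative_linear[OF F]]
    by (simp add: has_vector_derivative_def o_def)
qed

lemma differential_eqI:
  assumes F: "(F has_derivative D) (at x within S2)"
    and x: "x \<in> S2" and v: "v \<in> tangent_plane x"
  shows "differential F x v = D v"
proof -
  obtain c where c: "c 0 = x" "range c \<subseteq> S2" "(c has_vector_derivative v) (at 0)"
    using sphere_curve[OF x v] .
  have F': "(F has_derivative differential F x) (at x within S2)"
    using F unfolding differential_def
    by (metis differentiableI frechet_derivative_works)
  show ?thesis
    using has_derivative_within_S2_curve[OF F' c] has_derivative_within_S2_curve[OF F c]
      vector_derivative_unique_at by blast
qed

lemma frame: "is_frame x (frame x)"
proof -
  have "subspace (tangent_plane x)"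
    by (auto simp: tangent_plane_def subspace_def inner_add_right)
  from orthonormal_basis_subspace[OF this]
  have "\<exists>E. is_frame x E" unfolding is_frame_def by metis
  then show ?thesis unfolding frame_def by (rule someI_ex)
qed

lemma smooth_onD:
  assumes "smooth_on V G"
  shows "continuous_on V G" "y \<in> V \<Longrightarrow> G differentiable (at y)"
    "smooth_on V (\<lambda>y. frechet_derivative G (at y) v)"
proof -
  have k: "Ck_on k V G" for k using assms by (simp add: smooth_on_def)
  show "continuous_on V G" using k[of 0] by simp
  show "G differentiable (at y)" if "y \<in> V" using k[of "Suc 0"] that by simp
  show "smooth_on V (\<lambda>y. frechet_derivative G (at y) v)"
    using k[of "Suc _"] by (simp add: smooth_on_def)
qed

lemma has_derivative_within_S2I:
  assumes "open V" "x \<in> V" "x \<in> S2" "\<And>y. y \<in> V \<inter> S2 \<Longrightarrow> F y = G y"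
    and G: "(G has_derivative D) (at x within S2)"
  shows "(F has_derivative D) (at x within S2)"
proof -
  obtain d where d: "d > 0" "ball x d \<subseteq> V" using assms openE by blast
  show ?thesis
  proof (rule has_derivative_transform_within[OF G d(1) assms(3)])
    fix y assume "y \<in> S2" "dist y x < d"
    then show "G y = F y" using d assms(4)[of y] by (auto simp: dist_commute subset_iff)
  qed
qed

lemma smooth_S2_has_derivative:
  assumes F: "smooth_S2 F" and x: "x \<in> S2"
  shows "(F has_derivative differential F x) (at x within S2)"
proof -
  obtain V G where G: "open V" "x \<in> V" "smooth_on V G" "\<forall>y\<in>V \<inter> S2. F y = G y"
    using F x unfolding smooth_S2_def by blast
  have "(G has_derivative frechet_derivative G (at x)) (at x within S2)"
    using smooth_onD(2)[OF G(3,2)] frechet_derivative_works has_derivative_at_withinI by blast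
  then have "(F has_derivative frechet_derivative G (at x)) (at x within S2)"
    using has_derivative_within_S2I[OF G(1,2) x] G(4) by blast
  then show ?thesis
    unfolding differential_def by (metis differentiableI frechet_derivative_works)
qed

lemma grad:
  assumes h: "h differentiable (at x within S2)" and v: "v \<in> tangent_plane x"
    and x: "x \<in> S2"
  shows "grad h x \<in> tangent_plane x" "grad h x \<bullet> v = differential h x v"
proof -
  have lin: "linear (differential h x)"
    using h unfolding differential_def frechet_derivative_works
    by (rule has_derivative_linear)
  define w where "w = tproj x (adjoint (differential h x) 1)"
  have xx: "x \<bullet> x = 1" using x by (simp add: dot_square_norm)
  have w: "w \<in> tangent_plane x \<and> (\<forall>v\<in>tangent_plane x. w \<bullet> v = differential h x v)"
    using adjoint_works[OF lin, of _ 1]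
    by (auto simp: w_def tproj_def tangent_plane_def inner_diff_right inner_diff_left xx
        inner_commute)
  moreover have "w' = w"
    if w': "w' \<in> tangent_plane x \<and> (\<forall>v\<in>tangent_plane x. w' \<bullet> v = differential h x v)" for w'
  proof -
    have "w' - w \<in> tangent_plane x"
      using w w' by (auto simp: tangent_plane_def inner_diff_right)
    then have "(w' - w) \<bullet> (w' - w) = 0" using w w' by (simp add: inner_diff_left)
    then show ?thesis by simp
  qed
  ultimately have "grad h x = w" unfolding grad_def by (rule the_equality)
  then show "grad h x \<in> tangent_plane x" "grad h x \<bullet> v = differential h x v"
    using w v by auto
qed

lemma nabla_metric:
  assumes X: "vector_field X" and Y: "vector_field Y" and Z: "vector_field Z" and x: "x \<in> S2"
  shows "differential (\<lambda>y. Y y \<bullet> Z y) x (X x) = nabla X Y x \<bullet> Z x + Y x \<bullet> nabla X Z x"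
proof -
  have T: "X x \<in> tangent_plane x" "x \<bullet> Y x = 0" "x \<bullet> Z x = 0" "Y x \<bullet> x = 0"
    using X Y Z x by (auto simp: vector_field_def tangent_plane_def inner_commute)
  have D: "(Y has_derivative differential Y x) (at x within S2)"
      "(Z has_derivative differential Z x) (at x within S2)"
    using Y Z x smooth_S2_has_derivative by (auto simp: vector_field_def)
  show ?thesis
    using differential_eqI[OF has_derivative_inner[OF D] x T(1)] T
    by (simp add: nabla_def cov_deriv_def tproj_def inner_diff_left inner_diff_right)
qed

lemma double_difference_MVT:
  fixes G :: "'a::euclidean_space \<Rightarrow> real"
  assumes G: "smooth_on V G" and s: "s > 0"
    and V: "\<And>a b. \<lbrakk>0 \<le> a; a \<le> s; 0 \<le> b; b \<le> s\<rbrakk> \<Longrightarrow> x + a *\<^sub>R u + b *\<^sub>R v \<in> V"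
  shows "\<exists>a b. 0 < a \<and> a < s \<and> 0 < b \<and> b < s \<and>
    G (x + s *\<^sub>R u + s *\<^sub>R v) - G (x + s *\<^sub>R u) - G (x + s *\<^sub>R v) + G x =
    s * s * frechet_derivative (\<lambda>y. frechet_derivative G (at y) u)
                (at (x + a *\<^sub>R u + b *\<^sub>R v)) v"
proof -
  have line: "((\<lambda>t. H (z + t *\<^sub>R w)) has_real_derivative
        frechet_derivative H (at (z + t *\<^sub>R w)) w) (at t)"
    if "smooth_on V H" "z + t *\<^sub>R w \<in> V" for H :: "'a \<Rightarrow> real" and z w t
  proof -
    have H: "(H has_derivative frechet_derivative H (at (z + t *\<^sub>R w))) (at (z + t *\<^sub>R w))"
      using smooth_onD(2)[OF that] frechet_derivative_works by blast
    have c: "((\<lambda>t. z + t *\<^sub>R w) has_derivative (\<lambda>t. t *\<^sub>R w)) (at t)"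
      by (auto intro!: derivative_eq_intros)
    have "(\<lambda>h. frechet_derivative H (at (z + t *\<^sub>R w)) (h *\<^sub>R w)) =
        (*) (frechet_derivative H (at (z + t *\<^sub>R w)) w)"
      using linear_scale[OF has_derivative_linear[OF H]] by (auto simp: fun_eq_iff)
    with has_derivative_compose[OF c H] show ?thesis
      unfolding has_field_derivative_def by (simp only:)
  qed
  let ?Gu = "\<lambda>y. frechet_derivative G (at y) u"
  define \<phi> where "\<phi> = (\<lambda>t. G ((x + s *\<^sub>R v) + t *\<^sub>R u) - G (x + t *\<^sub>R u))"
  have "\<exists>a. 0 < a \<and> a < s \<and> \<phi> s - \<phi> 0 = (s - 0) *
      (?Gu ((x + s *\<^sub>R v) + a *\<^sub>R u) - ?Gu (x + a *\<^sub>R u))"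
    unfolding \<phi>_def
  proof (rule MVT2[OF s])
    fix t assume t: "0 \<le> t" "t \<le> s"
    have 1: "(x + s *\<^sub>R v) + t *\<^sub>R u \<in> V" using V[of t s] t s by (simp add: ac_simps)
    have 2: "x + t *\<^sub>R u \<in> V" using V[of t 0] t s by simp
    show "((\<lambda>t. G ((x + s *\<^sub>R v) + t *\<^sub>R u) - G (x + t *\<^sub>R u)) has_real_derivative
        ?Gu ((x + s *\<^sub>R v) + t *\<^sub>R u) - ?Gu (x + t *\<^sub>R u)) (at t)"
      by (rule DERIV_diff[OF line[OF G 1] line[OF G 2]])
  qed
  then obtain a where a: "0 < a" "a < s" and
    eq1: "\<phi> s - \<phi> 0 = s * (?Gu ((x + s *\<^sub>R v) + a *\<^sub>R u) - ?Gu (x + a *\<^sub>R u))" by auto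
  have "\<exists>b. 0 < b \<and> b < s \<and> ?Gu ((x + a *\<^sub>R u) + s *\<^sub>R v) - ?Gu ((x + a *\<^sub>R u) + 0 *\<^sub>R v) =
      (s - 0) * frechet_derivative ?Gu (at ((x + a *\<^sub>R u) + b *\<^sub>R v)) v"
  proof (rule MVT2[OF s, of "\<lambda>t. ?Gu ((x + a *\<^sub>R u) + t *\<^sub>R v)"])
    fix t assume t: "0 \<le> t" "t \<le> s"
    have 1: "(x + a *\<^sub>R u) + t *\<^sub>R v \<in> V" using V[of a t] a t by simp
    show "((\<lambda>t. ?Gu ((x + a *\<^sub>R u) + t *\<^sub>R v)) has_real_derivative
        frechet_derivative ?Gu (at ((x + a *\<^sub>R u) + t *\<^sub>R v)) v) (at t)"
      by (rule line[OF smooth_onD(3)[OF G] 1])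
  qed
  then obtain b where b: "0 < b" "b < s" and
    eq2: "?Gu ((x + a *\<^sub>R u) + s *\<^sub>R v) - ?Gu (x + a *\<^sub>R u) =
      s * frechet_derivative ?Gu (at ((x + a *\<^sub>R u) + b *\<^sub>R v)) v" by auto
  show ?thesis
    using eq1 eq2 a b
    by (intro exI[of _ a] exI[of _ b]) (simp add: \<phi>_def algebra_simps)
qed

lemma second_derivative_symmetric:
  fixes G :: "'a::euclidean_space \<Rightarrow> real"
  assumes G: "smooth_on V G" and V: "open V" and x: "x \<in> V"
  shows "frechet_derivative (\<lambda>y. frechet_derivative G (at y) u) (at x) v =
         frechet_derivative (\<lambda>y. frechet_derivative G (at y) v) (at x) u"
    (is "?P x = ?Q x")
proof -
  define K where "K = norm u + norm v + 1"
  have K: "K > 0" by (auto simp: K_def add_nonneg_pos)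
  obtain d where d: "d > 0" "ball x d \<subseteq> V" using V x openE by blast
  define s where "s = (\<lambda>n. d / K / real (n + 2))"
  have s0: "s n > 0" for n using d K by (simp add: s_def)
  have near: "dist (x + a *\<^sub>R u' + b *\<^sub>R v') x < s n * K"
    if "0 \<le> a" "a \<le> s n" "0 \<le> b" "b \<le> s n" "(u' = u \<and> v' = v) \<or> (u' = v \<and> v' = u)"
    for a b n u' v'
  proof -
    have "dist (x + a *\<^sub>R u' + b *\<^sub>R v') x \<le> a * norm u' + b * norm v'"
      using norm_triangle_ineq[of "a *\<^sub>R u'" "b *\<^sub>R v'"] that by (simp add: dist_norm)
    also have "\<dots> \<le> s n * norm u' + s n * norm v'"
      using that by (intro add_mono mult_right_mono) auto
    also have "\<dots> < s n * K" using s0[of n] that by (auto simp: K_def algebra_simps)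
    finally show ?thesis .
  qed
  have sK: "s n * K \<le> d" for n using d K by (simp add: s_def divide_simps)
  have inV: "x + a *\<^sub>R u' + b *\<^sub>R v' \<in> V"
    if "0 \<le> a" "a \<le> s n" "0 \<le> b" "b \<le> s n" "(u' = u \<and> v' = v) \<or> (u' = v \<and> v' = u)"
    for a b n u' v'
    using near[OF that] sK[of n] d(2) by (auto simp: dist_commute subset_iff)
  have "\<exists>y z. dist y x < s n * K \<and> dist z x < s n * K \<and> ?P y = ?Q z" for n
  proof -
    obtain a b where 1: "0 < a" "a < s n" "0 < b" "b < s n"
      "G (x + s n *\<^sub>R u + s n *\<^sub>R v) - G (x + s n *\<^sub>R u) - G (x + s n *\<^sub>R v) + G x =
        s n * s n * ?P (x + a *\<^sub>R u + b *\<^sub>R v)"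
      using double_difference_MVT[OF G s0, of n x u v] inV[of _ n _ u v] by blast
    obtain a' b' where 2: "0 < a'" "a' < s n" "0 < b'" "b' < s n"
      "G (x + s n *\<^sub>R v + s n *\<^sub>R u) - G (x + s n *\<^sub>R v) - G (x + s n *\<^sub>R u) + G x =
        s n * s n * ?Q (x + a' *\<^sub>R v + b' *\<^sub>R u)"
      using double_difference_MVT[OF G s0, of n x v u] inV[of _ n _ v u] by blast
    have e: "x + s n *\<^sub>R v + s n *\<^sub>R u = x + s n *\<^sub>R u + s n *\<^sub>R v" by simp
    have "s n * s n * ?P (x + a *\<^sub>R u + b *\<^sub>R v) = s n * s n * ?Q (x + a' *\<^sub>R v + b' *\<^sub>R u)"
      using 1(5) 2(5) unfolding e by linarith
    then have "?P (x + a *\<^sub>R u + b *\<^sub>R v) = ?Q (x + a' *\<^sub>R v + b' *\<^sub>R u)"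
      using s0[of n] by simp
    then show ?thesis
      using near[of a n b u v] near[of a' n b' v u] 1 2 by (meson less_imp_le)
  qed
  then obtain y z where yz: "\<And>n. dist (y n) x < s n * K" "\<And>n. dist (z n) x < s n * K"
    "\<And>n. ?P (y n) = ?Q (z n)" by metis
  have "(\<lambda>n. d / real (n + 2)) \<longlonglongrightarrow> 0"
    using LIMSEQ_ignore_initial_segment[OF lim_const_over_n[of d], of 2] by simp
  moreover have "s n * K = d / real (n + 2)" for n using K by (simp add: s_def)
  ultimately have lim: "(\<lambda>n. s n * K) \<longlonglongrightarrow> 0" by simp
  have "y \<longlonglongrightarrow> x" "z \<longlonglongrightarrow> x"
    using yz(1,2) less_imp_le
    by (auto simp: tendsto_dist_iff[of _ x] intro!: tendsto_sandwich[OF _ _ tendsto_const lim]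
        always_eventually)
  moreover have "isCont ?P x" "isCont ?Q x"
    using smooth_onD(1)[OF smooth_onD(3)[OF smooth_onD(3)[OF G]]] V x
    by (auto simp: continuous_on_eq_continuous_at)
  ultimately have "(\<lambda>n. ?P (y n)) \<longlonglongrightarrow> ?P x" "(\<lambda>n. ?Q (z n)) \<longlonglongrightarrow> ?Q x"
    using isCont_tendsto_compose by blast+
  then show ?thesis using yz(3) LIMSEQ_unique by simp
qed

text \<open>The commutator of the derivations \<open>X\<close> and \<open>Y\<close> is \<open>nabla X Y - nabla Y X\<close>.\<close>

lemma nabla_torsion_free:
  assumes X: "vector_field X" and Y: "vector_field Y" and g: "smooth_S2 g" and x: "x \<in> S2"
  shows "differential (\<lambda>y. differential g y (Y y)) x (X x)
       - differential (\<lambda>y. differential g y (X y)) x (Y x)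
       = (differential g x (nabla X Y x - nabla Y X x) :: real)"
proof -
  obtain V G where G: "open V" "x \<in> V" "smooth_on V G" "\<forall>y\<in>V \<inter> S2. g y = G y"
    using g x unfolding smooth_S2_def by blast
  let ?G = "\<lambda>y. frechet_derivative G (at y)"
  have GD: "(G has_derivative ?G y) (at y)" if "y \<in> V" for y
    using smooth_onD(2)[OF G(3) that] frechet_derivative_works by blast
  have dg: "differential g y w = ?G y w" if "y \<in> V \<inter> S2" "w \<in> tangent_plane y" for y w
    using that G has_derivative_within_S2I[OF G(1), of y g G]
    by (intro differential_eqI) (auto intro: has_derivative_at_withinI[OF GD])
  have expand: "?G y w = (\<Sum>b\<in>Basis. (w \<bullet> b) * ?G y b)" if "y \<in> V" for y w
  proof -
    have "?G y w = ?G y (\<Sum>b\<in>Basis. (w \<bullet> b) *\<^sub>R b)" by (simp add: euclidean_representation)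
    also have "\<dots> = (\<Sum>b\<in>Basis. (w \<bullet> b) * ?G y b)"
      using has_derivative_linear[OF GD[OF that]]
      by (simp add: linear_sum linear_scale)
    finally show ?thesis .
  qed
  define H where "H = (\<lambda>b. frechet_derivative (\<lambda>y. ?G y b) (at x))"
  have HD: "((\<lambda>y. ?G y b) has_derivative H b) (at x within S2)" for b
    unfolding H_def
    using smooth_onD(2)[OF smooth_onD(3)[OF G(3)] G(2)] frechet_derivative_works
      has_derivative_at_withinI by blast
  have key: "differential (\<lambda>y. differential g y (Z y)) x w =
      ?G x (differential Z x w) + (\<Sum>b\<in>Basis. \<Sum>c\<in>Basis. (Z x \<bullet> b) * (w \<bullet> c) * H b c)"
    if Z: "vector_field Z" and w: "w \<in> tangent_plane x" for Z w
  proof -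
    have ZD: "(Z has_derivative differential Z x) (at x within S2)"
      using Z x smooth_S2_has_derivative by (auto simp: vector_field_def)
    have "((\<lambda>y. \<Sum>b\<in>Basis. (Z y \<bullet> b) * ?G y b) has_derivative
        (\<lambda>w. \<Sum>b\<in>Basis. (Z x \<bullet> b) * H b w + (differential Z x w \<bullet> b) * ?G x b)) (at x within S2)"
      by (intro has_derivative_sum has_derivative_mult has_derivative_inner_left ZD HD)
    then have "((\<lambda>y. differential g y (Z y)) has_derivative
        (\<lambda>w. \<Sum>b\<in>Basis. (Z x \<bullet> b) * H b w + (differential Z x w \<bullet> b) * ?G x b)) (at x within S2)"
    proof (rule has_derivative_within_S2I[OF G(1,2) x, rotated])
      fix y assume y: "y \<in> V \<inter> S2"
      then have "Z y \<in> tangent_plane y" using Z by (auto simp: vector_field_def)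
      then show "differential g y (Z y) = (\<Sum>b\<in>Basis. (Z y \<bullet> b) * ?G y b)"
        using dg[OF y] expand[of y "Z y"] y by auto
    qed
    from differential_eqI[OF this x w]
    have "differential (\<lambda>y. differential g y (Z y)) x w =
        (\<Sum>b\<in>Basis. (Z x \<bullet> b) * H b w) + ?G x (differential Z x w)"
      by (simp only: sum.distrib expand[OF G(2), of "differential Z x w"])
    moreover have "H b w = (\<Sum>c\<in>Basis. (w \<bullet> c) * H b c)" for b
    proof -
      have "H b w = H b (\<Sum>c\<in>Basis. (w \<bullet> c) *\<^sub>R c)" by (simp add: euclidean_representation)
      also have "\<dots> = (\<Sum>c\<in>Basis. (w \<bullet> c) * H b c)"
        using has_derivative_linear[OF HD] by (simp add: linear_sum linear_scale)
      finally show ?thesis .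
    qed
    ultimately show ?thesis by (simp add: sum_distrib_left mult.assoc)
  qed
  have T: "X x \<in> tangent_plane x" "Y x \<in> tangent_plane x"
    using X Y x by (auto simp: vector_field_def)
  have Hsym: "H b c = H c b" for b c
    unfolding H_def by (rule second_derivative_symmetric[OF G(3,1,2)])
  have "(\<Sum>b\<in>Basis. \<Sum>c\<in>Basis. (Y x \<bullet> b) * (X x \<bullet> c) * H b c) =
      (\<Sum>b\<in>Basis. \<Sum>c\<in>Basis. (X x \<bullet> b) * (Y x \<bullet> c) * H b c)"
    by (subst sum.swap, intro sum.cong refl) (subst Hsym, simp)
  then have "differential (\<lambda>y. differential g y (Y y)) x (X x)
       - differential (\<lambda>y. differential g y (X y)) x (Y x)
       = ?G x (differential Y x (X x)) - ?G x (differential X x (Y x))"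
    using key[OF Y T(1)] key[OF X T(2)] by simp
  also have "\<dots> = ?G x (differential Y x (X x) - differential X x (Y x))"
    using has_derivative_linear[OF GD[OF G(2)]] by (simp add: linear_diff)
  also have "differential Y x (X x) - differential X x (Y x) = nabla X Y x - nabla Y X x"
  proof -
    have normal: "x \<bullet> differential Z x w = - (w \<bullet> Z x)"
      if Z: "vector_field Z" and w: "w \<in> tangent_plane x" for Z w
    proof -
      have ZD: "(Z has_derivative differential Z x) (at x within S2)"
        using Z x smooth_S2_has_derivative by (auto simp: vector_field_def)
      have "((\<lambda>y. y \<bullet> Z y) has_derivative (\<lambda>w. x \<bullet> differential Z x w + w \<bullet> Z x)) (at x within S2)"
        by (intro has_derivative_inner ZD has_derivative_ident)
      then have "differential (\<lambda>y. y \<bullet> Z y) x w = x \<bullet> differential Z x w + w \<bullet> Z x"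
        using differential_eqI x w by blast
      moreover have "((\<lambda>y. y \<bullet> Z y) has_derivative (\<lambda>w. 0)) (at x within S2)"
        by (rule has_derivative_within_S2I[of UNIV x _ "\<lambda>_. 0"])
          (use Z x in \<open>auto simp: vector_field_def tangent_plane_def\<close>)
      then have "differential (\<lambda>y. y \<bullet> Z y) x w = 0" using differential_eqI x w by blast
      ultimately show ?thesis by simp
    qed
    show ?thesis
      using normal[OF Y T(1)] normal[OF X T(2)]
      by (simp add: nabla_def cov_deriv_def tproj_def inner_commute)
  qed
  also have "?G x (nabla X Y x - nabla Y X x) = differential g x (nabla X Y x - nabla Y X x)"
  proof (rule dg[symmetric])
    have xx: "x \<bullet> x = 1" using x by (simp add: dot_square_norm)
    show "nabla X Y x - nabla Y X x \<in> tangent_plane x"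
      by (simp add: nabla_def cov_deriv_def tproj_def tangent_plane_def inner_diff_right xx)
  qed (use G x in auto)
  finally show ?thesis .
qed

end

theory Submission
  imports Defs
begin

text \<open>Write \<open>A = \<nabla>\<sigma>\<close>, a symmetric endomorphism with trace \<open>- lam f\<close>, so that
  \<open>X(\<sigma>) = \<nabla>\<^bsub>\<sigma>\<^esub>\<sigma> = A \<sigma>\<close>.  Differentiating the eigenvalue equation gives
  \<open>\<nabla>\<^sup>*\<nabla>\<sigma> = (lam - 1) \<sigma>\<close> and hence \<open>\<Delta>(\<bar>\<sigma>\<bar>\<^sup>2 / 2) = (lam - 1) \<bar>\<sigma>\<bar>\<^sup>2 - \<bar>A\<bar>\<^sup>2\<close>, which
  settles \<open>lam \<le> 1\<close>.  If \<open>lam > 1\<close> and \<open>p \<noteq> 0\<close>, the equation makes \<open>A\<^sup>2 \<sigma>\<close> a multiple of \<open>\<sigma>\<close>,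
  and Cayley--Hamilton together with the independence of \<open>A \<sigma>\<close> and \<open>\<sigma>\<close> forces \<open>tr A = 0\<close> on
  \<open>U\<close>; then \<open>f\<close>, and with it \<open>\<sigma>\<close>, vanishes on \<open>U\<close>, a contradiction.  If \<open>lam > 1\<close> and
  \<open>p = 0\<close>, the equation reads \<open>lam - 1 = - q \<Delta>(\<bar>\<sigma>\<bar>\<^sup>2 / 2)\<close>.\<close>

section \<open>Tangent planes and orthogonal projection\<close>

lemma linear_basis_expand:
  fixes L :: "'a::euclidean_space \<Rightarrow> 'b::real_vector"
  assumes "linear L"
  shows "L v = (\<Sum>b\<in>Basis. (v \<bullet> b) *\<^sub>R L b)"
proof -
  have "L v = L (\<Sum>b\<in>Basis. (v \<bullet> b) *\<^sub>R b)" by (simp add: euclidean_representation)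
  then show ?thesis using assms by (simp add: linear_sum linear_scale)
qed

lemma S2_inner_self: "x \<in> S2 \<Longrightarrow> x \<bullet> x = 1"
  by (simp add: dot_square_norm)

lemma tproj_tangent: "x \<in> S2 \<Longrightarrow> tproj x w \<in> tangent_plane x"
  by (simp add: tproj_def tangent_plane_def inner_diff_right S2_inner_self)

lemma tproj_id: "v \<in> tangent_plane x \<Longrightarrow> tproj x v = v"
  by (simp add: tproj_def tangent_plane_def)

lemma tproj_inner: "v \<in> tangent_plane x \<Longrightarrow> tproj x w \<bullet> v = w \<bullet> v"
  by (simp add: tproj_def tangent_plane_def inner_diff_left)

lemma tangent_plane_eqI:
  assumes "a \<in> tangent_plane x" "b \<in> tangent_plane x"
    and "\<And>v. v \<in> tangent_plane x \<Longrightarrow> a \<bullet> v = b \<bullet> v"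
  shows "a = b"
proof -
  have "a - b \<in> tangent_plane x"
    using assms(1,2) by (simp add: tangent_plane_def inner_diff_right)
  then have "(a - b) \<bullet> (a - b) = 0" using assms(3) by (simp add: inner_diff_left)
  then show ?thesis by simp
qed

subsection \<open>Traces over an orthonormal frame\<close>

lemma frame_tangent: "e \<in> frame x \<Longrightarrow> e \<in> tangent_plane x"
  using frame[of x] by (auto simp: is_frame_def)

lemma finite_frame: "finite (frame x)"
  using frame[of x] pairwise_orthogonal_imp_finite by (auto simp: is_frame_def)

lemma frame_inner:
  "\<lbrakk>e \<in> frame x; d \<in> frame x\<rbrakk> \<Longrightarrow> e \<bullet> d = (if e = d then 1 else 0)"
  using frame[of x] by (auto simp: is_frame_def pairwise_def orthogonal_def dot_square_norm)

text \<open>Both sides are tangent, and \<open>?w - u\<close> is orthogonal to the frame, hence to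
  its span, the whole tangent plane.\<close>

lemma frame_expand:
  assumes x: "x \<in> S2"
  shows "(\<Sum>e\<in>frame x. (u \<bullet> e) *\<^sub>R e) = tproj x u"
proof -
  let ?w = "\<Sum>e\<in>frame x. (u \<bullet> e) *\<^sub>R e"
  have T: "?w \<in> tangent_plane x"
    using frame_tangent[of _ x] by (auto simp: tangent_plane_def inner_sum_right)
  have E: "?w \<bullet> d = u \<bullet> d" if "d \<in> frame x" for d
    using that finite_frame[of x]
    by (simp add: inner_sum_left frame_inner if_distrib cong: if_cong)
  have "(?w - u) \<bullet> v = 0" if "v \<in> tangent_plane x" for v
  proof -
    have "v \<in> span (frame x)" using that frame[of x] by (simp add: is_frame_def)
    then show ?thesis
      by (induction rule: span_induct_alt)
        (auto simp: inner_add_right inner_diff_left E)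
  qed
  then have "?w \<bullet> v = tproj x u \<bullet> v" if "v \<in> tangent_plane x" for v
    using that by (simp add: tproj_inner inner_diff_left)
  then show ?thesis using T tproj_tangent[OF x] tangent_plane_eqI by blast
qed

lemma frame_inner_sum:
  assumes x: "x \<in> S2" and v: "v \<in> tangent_plane x"
  shows "(\<Sum>e\<in>frame x. (u \<bullet> e) * (v \<bullet> e)) = u \<bullet> v"
proof -
  have "(\<Sum>e\<in>frame x. (u \<bullet> e) * (v \<bullet> e)) = (\<Sum>e\<in>frame x. (u \<bullet> e) *\<^sub>R e) \<bullet> v"
    by (simp add: inner_sum_left inner_commute[of v])
  then show ?thesis using frame_expand[OF x] tproj_inner[OF v] by simp
qed

text \<open>The frame together with the unit normal \<open>x\<close> is an orthonormal basis of the
  ambient space, and the trace does not depend on the basis. This replaces a frame chosen separately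
  at each point by the fixed \<open>Basis\<close>, whose sums can be differentiated.\<close>

lemma frame_trace:
  assumes x: "x \<in> S2" and L: "linear L"
  shows "(\<Sum>e\<in>frame x. L e \<bullet> e) = (\<Sum>b\<in>Basis. L b \<bullet> b) - L x \<bullet> x"
proof -
  note ex = linear_basis_expand[OF L]
  have "(\<Sum>e\<in>frame x. L e \<bullet> e) = (\<Sum>e\<in>frame x. \<Sum>b\<in>Basis. (e \<bullet> b) * (L b \<bullet> e))"
    by (subst ex) (simp add: inner_sum_left)
  also have "\<dots> = (\<Sum>b\<in>Basis. \<Sum>e\<in>frame x. (e \<bullet> b) * (L b \<bullet> e))" by (rule sum.swap)
  also have "\<dots> = (\<Sum>b\<in>Basis. L b \<bullet> (\<Sum>e\<in>frame x. (b \<bullet> e) *\<^sub>R e))"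
    by (simp add: inner_sum_right inner_commute)
  also have "\<dots> = (\<Sum>b\<in>Basis. L b \<bullet> b) - (\<Sum>b\<in>Basis. (x \<bullet> b) * (L b \<bullet> x))"
    by (simp add: frame_expand[OF x] tproj_def inner_diff_right sum_subtractf)
  also have "(\<Sum>b\<in>Basis. (x \<bullet> b) * (L b \<bullet> x)) = L x \<bullet> x"
    unfolding ex[of x] by (simp add: inner_sum_left)
  finally show ?thesis .
qed

lemma frame_sum_self:
  assumes x: "x \<in> S2"
  shows "(\<Sum>e\<in>frame x. e \<bullet> e) = 2"
proof -
  have "(\<Sum>e\<in>frame x. e \<bullet> e) = (\<Sum>b\<in>(Basis::(real^3) set). b \<bullet> b) - x \<bullet> x"
    using frame_trace[OF x linear_id] by simp
  also have "\<dots> = 2" using S2_inner_self[OF x] by (simp add: inner_Basis)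
  finally show ?thesis .
qed

lemma frame_pair:
  assumes x: "x \<in> S2"
  obtains a b where "frame x = {a, b}" "a \<noteq> b"
proof -
  have "card (frame x) = 2"
  proof -
    have "real (card (frame x)) = (\<Sum>e\<in>frame x. e \<bullet> e)"
      by (simp add: frame_inner)
    also have "\<dots> = 2" by (rule frame_sum_self[OF x])
    finally show ?thesis by simp
  qed
  then show ?thesis using that by (meson card_2_iff)
qed

text \<open>By Cayley-Hamilton in dimension two, \<open>A (A s)\<close> is trace times
  \<open>A s\<close> minus determinant times \<open>s\<close>, so a nonzero trace would put
  \<open>A s\<close> on the line of \<open>s\<close>. The condition \<open>A s \<noteq> s\<close>
  keeps the set \<open>{A s, s}\<close> from collapsing to a singleton, which could be
  independent.\<close>

lemma trace_eq_0_of_square_parallel: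
  assumes x: "x \<in> S2"
    and T: "\<And>v. v \<in> tangent_plane x \<Longrightarrow> A v \<in> tangent_plane x"
    and lin: "\<And>u v. u \<in> tangent_plane x \<Longrightarrow> v \<in> tangent_plane x \<Longrightarrow> A (u + v) = A u + A v"
      "\<And>c v. v \<in> tangent_plane x \<Longrightarrow> A (c *\<^sub>R v) = c *\<^sub>R A v"
    and s: "s \<in> tangent_plane x"
    and sq: "A (A s) = \<mu> *\<^sub>R s" and ind: "A s \<noteq> s" "independent {A s, s}"
  shows "(\<Sum>e\<in>frame x. A e \<bullet> e) = 0"
proof -
  obtain a b where ab: "frame x = {a, b}" "a \<noteq> b" using frame_pair[OF x] .
  have tab: "a \<in> tangent_plane x" "b \<in> tangent_plane x" using frame_tangent ab by auto
  have ex: "v = (v \<bullet> a) *\<^sub>R a + (v \<bullet> b) *\<^sub>R b" if "v \<in> tangent_plane x" for v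
    using frame_expand[OF x, of v] tproj_id[OF that] ab by simp
  have sc: "c *\<^sub>R v \<in> tangent_plane x" if "v \<in> tangent_plane x" for c v
    using that by (simp add: tangent_plane_def)
  define m where "m = A a \<bullet> a"
  define n where "n = A a \<bullet> b"
  define k where "k = A b \<bullet> a"
  define l where "l = A b \<bullet> b"
  have Aa: "A a = m *\<^sub>R a + n *\<^sub>R b" and Ab: "A b = k *\<^sub>R a + l *\<^sub>R b"
    unfolding m_def n_def k_def l_def using ex T tab by auto
  have Av: "A (i *\<^sub>R a + j *\<^sub>R b) = (i * m + j * k) *\<^sub>R a + (i * n + j * l) *\<^sub>R b" for i j
    using tab sc by (simp add: lin Aa Ab algebra_simps)
  obtain i j where ij: "s = i *\<^sub>R a + j *\<^sub>R b" using ex[OF s] by blast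
  \<comment> \<open>Cayley-Hamilton, checked in coordinates: the trace is \<open>m + l\<close>, the
    determinant \<open>m * l - n * k\<close>.\<close>
  have "A (A s) = (m + l) *\<^sub>R A s - (m * l - n * k) *\<^sub>R s"
    unfolding ij Av by (simp add: algebra_simps)
  with sq have eq: "(m + l) *\<^sub>R A s = (\<mu> + (m * l - n * k)) *\<^sub>R s"
    by (simp add: algebra_simps)
  have "m + l = 0"
  proof (rule ccontr)
    assume nz: "m + l \<noteq> 0"
    have "A s = (1 / (m + l)) *\<^sub>R ((m + l) *\<^sub>R A s)" using nz by simp
    then have "A s \<in> span {s}" unfolding eq by (auto simp: span_breakdown_eq)
    moreover have "A s \<notin> span {s}" using ind by (simp add: independent_insert)
    ultimately show False by blast
  qed
  then show ?thesis using ab by (simp add: m_def l_def)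
qed

subsection \<open>Jets of a function along the sphere\<close>

text \<open>\<open>g\<close>, \<open>H\<close> and \<open>T\<close> are the gradient, the Hessian and the third derivative of an ambient
  extension of \<open>f\<close> near \<open>x\<close>.\<close>

locale ambient_jet =
  fixes V :: "(real^3) set" and x :: "real^3" and f :: "real^3 \<Rightarrow> real"
    and g :: "real^3 \<Rightarrow> real^3" and H T :: "real^3 \<Rightarrow> real^3 \<Rightarrow> real^3"
  assumes V: "open V" "x \<in> V" and x: "x \<in> S2"
    and f: "y \<in> V \<inter> S2 \<Longrightarrow> (f has_derivative (\<lambda>v. g y \<bullet> v)) (at y within S2)"
    and g: "y \<in> V \<inter> S2 \<Longrightarrow> (g has_derivative H y) (at y within S2)"
    and H: "((\<lambda>y. H y u) has_derivative T u) (at x within S2)"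
    and H_sym: "y \<in> V \<inter> S2 \<Longrightarrow> H y u \<bullet> v = H y v \<bullet> u"
    and T_sym: "T u v \<bullet> w = T v u \<bullet> w" "T u v \<bullet> w = T u w \<bullet> v"

lemma smooth_S2_ambient_jet:
  assumes f: "smooth_S2 f" and x: "x \<in> S2"
  obtains V g H T where "ambient_jet V x f g H T"
proof -
  obtain V G where G: "open V" "x \<in> V" "smooth_on V G" "\<forall>y\<in>V \<inter> S2. f y = G y"
    using f x unfolding smooth_S2_def by blast
  define G1 where "G1 = (\<lambda>b y. frechet_derivative G (at y) b)"
  define G2 where "G2 = (\<lambda>b c y. frechet_derivative (G1 b) (at y) c)"
  define G3 where "G3 = (\<lambda>b c d y. frechet_derivative (G2 b c) (at y) d)"
  have s1: "smooth_on V (G1 b)" for b unfolding G1_def by (rule smooth_onD(3)[OF G(3)])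
  have s2: "smooth_on V (G2 b c)" for b c unfolding G2_def by (rule smooth_onD(3)[OF s1])
  have D0: "(G has_derivative (\<lambda>v. G1 v y)) (at y within S2)" if "y \<in> V" for y
    unfolding G1_def using smooth_onD(2)[OF G(3) that] frechet_derivative_works
      has_derivative_at_withinI by blast
  have D1: "(G1 b has_derivative (\<lambda>v. G2 b v y)) (at y within S2)" if "y \<in> V" for y b
    unfolding G2_def using smooth_onD(2)[OF s1 that] frechet_derivative_works
      has_derivative_at_withinI by blast
  have D2: "(G2 b c has_derivative (\<lambda>v. G3 b c v y)) (at y within S2)" if "y \<in> V" for y b c
    unfolding G3_def using smooth_onD(2)[OF s2 that] frechet_derivative_works
      has_derivative_at_withinI by blast
  have sym2: "G2 b c y = G2 c b y" if "y \<in> V" for b c y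
    unfolding G2_def G1_def by (rule second_derivative_symmetric[OF G(3,1) that])
  have sym23: "G3 b c d x = G3 b d c x" for b c d
    unfolding G3_def G2_def by (rule second_derivative_symmetric[OF s1 G(1,2)])
  \<comment> \<open>The second derivatives agree on all of the open set \<open>V\<close>, so their
    derivatives at \<open>x\<close> agree too.\<close>
  have sym12: "G3 b c d x = G3 c b d x" for b c d
  proof -
    have "frechet_derivative (G2 b c) (at x) = frechet_derivative (G2 c b) (at x)"
    proof (rule frechet_derivative_transform_within_open[OF _ G(1,2)])
      show "G2 b c differentiable at x" by (rule smooth_onD(2)[OF s2 G(2)])
    qed (use sym2 in auto)
    then show ?thesis by (simp add: G3_def)
  qed
  have lin_sum: "(\<Sum>b\<in>Basis. L b *\<^sub>R b) \<bullet> v = L v" if "linear L" for L :: "real^3 \<Rightarrow> real" and v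
    using linear_basis_expand[OF that, of v]
    by (simp add: inner_sum_left inner_commute[of v] mult.commute)
  have l1: "linear (\<lambda>b. G1 b y)" if "y \<in> V" for y
    using has_derivative_linear[OF D0[OF that]] .
  \<comment> \<open>A Frechet derivative is linear in its direction, the last index; the symmetries
    carry \<open>b\<close> to that place.\<close>
  have l2: "linear (\<lambda>b. G2 b c y)" if "y \<in> V" for y c
  proof -
    have "(\<lambda>b. G2 b c y) = (\<lambda>b. G2 c b y)" using sym2[OF that] by (rule ext)
    then show ?thesis using has_derivative_linear[OF D1[OF that, of c]] by simp
  qed
  have l3: "linear (\<lambda>b. G3 b c d x)" for c d
  proof -
    have "(\<lambda>b. G3 b c d x) = (\<lambda>b. G3 c d b x)"
      by (rule ext) (rule trans[OF sym12 sym23])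
    then show ?thesis using has_derivative_linear[OF D2[OF G(2), of c d]] by simp
  qed
  have "ambient_jet V x f (\<lambda>y. \<Sum>b\<in>Basis. G1 b y *\<^sub>R b) (\<lambda>y v. \<Sum>b\<in>Basis. G2 b v y *\<^sub>R b)
      (\<lambda>u v. \<Sum>b\<in>Basis. G3 b u v x *\<^sub>R b)"
  proof
    fix y assume y: "y \<in> V \<inter> S2"
    show "(f has_derivative (\<lambda>v. (\<Sum>b\<in>Basis. G1 b y *\<^sub>R b) \<bullet> v)) (at y within S2)"
      unfolding lin_sum[OF l1[OF IntD1[OF y]]]
      by (rule has_derivative_within_S2I[OF G(1) _ _ _ D0]) (use y G(4) in auto)
    show "((\<lambda>y. \<Sum>b\<in>Basis. G1 b y *\<^sub>R b) has_derivative (\<lambda>v. \<Sum>b\<in>Basis. G2 b v y *\<^sub>R b))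
        (at y within S2)"
      using y by (intro has_derivative_sum has_derivative_scaleR_left D1) auto
    show "(\<Sum>b\<in>Basis. G2 b u y *\<^sub>R b) \<bullet> v = (\<Sum>b\<in>Basis. G2 b v y *\<^sub>R b) \<bullet> u" for u v
      unfolding lin_sum[OF l2[OF IntD1[OF y]]] by (rule sym2[OF IntD1[OF y]])
  next
    show "((\<lambda>y. \<Sum>b\<in>Basis. G2 b u y *\<^sub>R b) has_derivative (\<lambda>v. \<Sum>b\<in>Basis. G3 b u v x *\<^sub>R b))
        (at x within S2)" for u
      using G(2) by (intro has_derivative_sum has_derivative_scaleR_left D2) auto
  next
    fix u v w
    show "(\<Sum>b\<in>Basis. G3 b u v x *\<^sub>R b) \<bullet> w = (\<Sum>b\<in>Basis. G3 b v u x *\<^sub>R b) \<bullet> w"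
      by (simp only: sym23[of _ u v])
    show "(\<Sum>b\<in>Basis. G3 b u v x *\<^sub>R b) \<bullet> w = (\<Sum>b\<in>Basis. G3 b u w x *\<^sub>R b) \<bullet> v"
      unfolding lin_sum[OF l3] by (rule trans[OF sym12 trans[OF sym23 sym12]])
  qed (use G x in auto)
  then show ?thesis by (rule that)
qed

section \<open>Derivatives of tangent fields\<close>

text \<open>Differentiate the identity \<open>y \<bullet> W y = 0\<close>, which holds on the whole
  sphere.\<close>

lemma tangent_field_derivative_normal:
  assumes W: "(W has_derivative D) (at x within S2)" and x: "x \<in> S2"
    and T: "\<And>y. y \<in> S2 \<Longrightarrow> W y \<in> tangent_plane y" and v: "v \<in> tangent_plane x"
  shows "x \<bullet> D v = - (W x \<bullet> v)"
proof -
  have "((\<lambda>y. y \<bullet> W y) has_derivative (\<lambda>w. x \<bullet> D w + w \<bullet> W x)) (at x within S2)"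
    by (intro has_derivative_inner W has_derivative_ident)
  then have "differential (\<lambda>y. y \<bullet> W y) x v = x \<bullet> D v + v \<bullet> W x"
    using differential_eqI x v by blast
  moreover have "((\<lambda>y. y \<bullet> W y) has_derivative (\<lambda>w. 0)) (at x within S2)"
    by (rule has_derivative_within_S2I[of UNIV x _ "\<lambda>_. 0"])
      (use T x in \<open>auto simp: tangent_plane_def\<close>)
  then have "differential (\<lambda>y. y \<bullet> W y) x v = 0" using differential_eqI x v by blast
  ultimately show ?thesis by (simp add: inner_commute)
qed

lemma cov_deriv_eqI:
  assumes "(W has_derivative D) (at x within S2)" "x \<in> S2" "v \<in> tangent_plane x"
  shows "cov_deriv W x v = tproj x (D v)"
  using differential_eqI[OF assms] by (simp add: cov_deriv_def)

text \<open>No differentiability is assumed: fields that agree near \<open>x\<close> have the same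
  Frechet derivatives there, so the choice made by \<open>frechet_derivative\<close> is the same for
  both.\<close>

lemma cov_deriv_cong:
  assumes "open V" "x \<in> V" "x \<in> S2" and XY: "\<And>y. y \<in> V \<inter> S2 \<Longrightarrow> X y = Y y"
  shows "cov_deriv X x v = cov_deriv Y x v"
proof -
  have "(X has_derivative D) (at x within S2) \<longleftrightarrow> (Y has_derivative D) (at x within S2)" for D
    using has_derivative_within_S2I[OF assms(1-3), of X Y D]
      has_derivative_within_S2I[OF assms(1-3), of Y X D] XY by auto
  then show ?thesis by (simp add: cov_deriv_def differential_def frechet_derivative_def)
qed

text \<open>The derivative at \<open>x\<close> of the extension of \<open>e\<close> is normal to the
  sphere. Hence the correction term of \<open>nabla2\<close> drops out when the rough Laplacian is
  computed with this extension.\<close>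

lemma tproj_field:
  assumes x: "x \<in> S2" and e: "e \<in> tangent_plane x"
  shows "((\<lambda>y. tproj y e) has_derivative (\<lambda>v. - ((v \<bullet> e) *\<^sub>R x))) (at x within S2)"
    "cov_deriv (\<lambda>y. tproj y e) x e = 0"
proof -
  have "x \<bullet> e = 0" using e by (simp add: tangent_plane_def)
  then show D: "((\<lambda>y. tproj y e) has_derivative (\<lambda>v. - ((v \<bullet> e) *\<^sub>R x))) (at x within S2)"
    unfolding tproj_def by (auto intro!: derivative_eq_intros)
  show "cov_deriv (\<lambda>y. tproj y e) x e = 0"
    unfolding cov_deriv_eqI[OF D x e] using S2_inner_self[OF x] by (simp add: tproj_def)
qed

subsection \<open>Gradients of eigenfunctions\<close>

locale gradient_jet = ambient_jet +
  fixes \<sigma> :: "real^3 \<Rightarrow> real^3"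
  assumes \<sigma>: "y \<in> S2 \<Longrightarrow> \<sigma> y = grad f y"
    and \<sigma>_tangent: "y \<in> S2 \<Longrightarrow> \<sigma> y \<in> tangent_plane y"
begin

lemma xV: "x \<in> V \<inter> S2"
  using V x by simp

lemma linear_H: "y \<in> V \<inter> S2 \<Longrightarrow> linear (H y)"
  using g has_derivative_linear by blast

lemma linear_T: "linear (T u)"
  using H has_derivative_linear by blast

lemma T_swap: "T u v = T v u"
  using T_sym(1) by (metis vector_eq_rdot)

lemma \<sigma>_eq: "y \<in> V \<inter> S2 \<Longrightarrow> \<sigma> y = tproj y (g y)"
proof -
  assume y: "y \<in> V \<inter> S2"
  have d: "f differentiable (at y within S2)" using f[OF y] by (rule differentiableI)
  have "grad f y = tproj y (g y)"
  proof (rule tangent_plane_eqI)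
    show "grad f y \<in> tangent_plane y"
      using grad(1)[OF d, of 0] y by (auto simp: tangent_plane_def)
    show "tproj y (g y) \<in> tangent_plane y" using y tproj_tangent by blast
    fix v assume v: "v \<in> tangent_plane y"
    then show "grad f y \<bullet> v = tproj y (g y) \<bullet> v"
      using grad(2)[OF d v] differential_eqI[OF f[OF y] _ v] y by (simp add: tproj_inner)
  qed
  then show ?thesis using \<sigma> y by simp
qed

lemma \<sigma>_derivative:
  assumes y: "y \<in> V \<inter> S2"
  shows "(\<sigma> has_derivative (\<lambda>v. H y v - ((y \<bullet> H y v + v \<bullet> g y) *\<^sub>R y + (y \<bullet> g y) *\<^sub>R v)))
    (at y within S2)"
proof -
  have "((\<lambda>y. g y - (y \<bullet> g y) *\<^sub>R y) has_derivative
      (\<lambda>v. H y v - ((y \<bullet> H y v + v \<bullet> g y) *\<^sub>R y + (y \<bullet> g y) *\<^sub>R v))) (at y within S2)"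
    by (auto intro!: derivative_eq_intros g[OF y] simp: algebra_simps)
  then show ?thesis
    using has_derivative_within_S2I[OF V(1), of y \<sigma> "\<lambda>y. g y - (y \<bullet> g y) *\<^sub>R y"] y \<sigma>_eq
    by (auto simp: tproj_def)
qed

text \<open>Subtracting the normal part of \<open>g\<close> and differentiating its factor
  \<open>y\<close> leaves a tangential term: the second fundamental form of the sphere times the
  normal derivative of the extension.\<close>

lemma cov_deriv_\<sigma>:
  assumes y: "y \<in> V \<inter> S2" and v: "v \<in> tangent_plane y"
  shows "cov_deriv \<sigma> y v = tproj y (H y v) - (y \<bullet> g y) *\<^sub>R v"
proof -
  have "y \<bullet> y = 1" "y \<bullet> v = 0" using y v S2_inner_self by (auto simp: tangent_plane_def)
  then show ?thesis
    unfolding cov_deriv_eqI[OF \<sigma>_derivative[OF y] IntD2[OF y] v]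
    by (simp add: tproj_def inner_add_right inner_diff_right algebra_simps)
qed

lemma cov_deriv_\<sigma>_tangent:
  assumes y: "y \<in> V \<inter> S2" and v: "v \<in> tangent_plane y"
  shows "cov_deriv \<sigma> y v \<in> tangent_plane y"
  using y tproj_tangent unfolding cov_deriv_def by blast

lemma cov_deriv_\<sigma>_sym:
  assumes y: "y \<in> V \<inter> S2" and v: "v \<in> tangent_plane y" and w: "w \<in> tangent_plane y"
  shows "cov_deriv \<sigma> y v \<bullet> w = cov_deriv \<sigma> y w \<bullet> v"
  using H_sym[OF y, of v w]
  by (simp add: cov_deriv_\<sigma>[OF y] v w inner_diff_left tproj_inner inner_commute[of v w])

text \<open>The second covariant derivative \<open>\<nabla>\<^sup>2\<sigma>\<close> at \<open>x\<close>, evaluated on the argument \<open>w\<close> of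
  \<open>\<nabla>\<sigma>\<close> and the direction \<open>e\<close> of the outer derivative.\<close>

definition hess\<sigma> :: "real^3 \<Rightarrow> real^3 \<Rightarrow> real^3"
  where "hess\<sigma> w e = tproj x (T w e) - (w \<bullet> e) *\<^sub>R tproj x (H x x) - (x \<bullet> H x w) *\<^sub>R e
    - (e \<bullet> g x + x \<bullet> H x e) *\<^sub>R w"

text \<open>This is the product rule for \<open>\<nabla>\<sigma>\<close> applied to
  \<open>W\<close>. It is used twice: with the extension of a frame vector for the rough Laplacian,
  and with \<open>W = \<sigma>\<close> for the Laplacian of the squared norm.\<close>

lemma cov_deriv_nabla:
  assumes W: "(W has_derivative D) (at x within S2)"
    and WT: "\<And>y. y \<in> S2 \<Longrightarrow> W y \<in> tangent_plane y" and e: "e \<in> tangent_plane x"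
  shows "cov_deriv (\<lambda>y. cov_deriv \<sigma> y (W y)) x e
    = hess\<sigma> (W x) e + cov_deriv \<sigma> x (cov_deriv W x e)"
proof -
  define u where "u = (\<lambda>y. H y (W y))"
  have u: "(u has_derivative (\<lambda>v. T (W x) v + H x (D v))) (at x within S2)"
  proof -
    \<comment> \<open>The derivative of \<open>H\<close> is known only for a fixed argument, so the
      moving argument \<open>W y\<close> is expanded in \<open>Basis\<close>; \<open>T_swap\<close>
      reassembles the result.\<close>
    have 1: "((\<lambda>y. \<Sum>b\<in>Basis. (W y \<bullet> b) *\<^sub>R H y b) has_derivative
        (\<lambda>v. \<Sum>b\<in>Basis. (W x \<bullet> b) *\<^sub>R T b v + (D v \<bullet> b) *\<^sub>R H x b)) (at x within S2)"
      by (intro has_derivative_sum has_derivative_scaleR has_derivative_inner_left W H)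
    note ex = linear_basis_expand
    have 2: "T (W x) v + H x (D v) = (\<Sum>b\<in>Basis. (W x \<bullet> b) *\<^sub>R T b v + (D v \<bullet> b) *\<^sub>R H x b)" for v
      using ex[OF linear_T, of v "W x"] ex[OF linear_H[OF xV], of "D v"]
      by (simp add: sum.distrib T_swap)
    show ?thesis
      unfolding 2 by (rule has_derivative_within_S2I[OF V x _ 1])
        (use ex[OF linear_H] in \<open>simp add: u_def\<close>)
  qed
  let ?Z = "\<lambda>y. u y - (y \<bullet> u y) *\<^sub>R y - (y \<bullet> g y) *\<^sub>R W y"
  let ?D = "\<lambda>v. (T (W x) v + H x (D v))
      - ((x \<bullet> (T (W x) v + H x (D v)) + v \<bullet> u x) *\<^sub>R x + (x \<bullet> u x) *\<^sub>R v)
      - ((x \<bullet> H x v + v \<bullet> g x) *\<^sub>R W x + (x \<bullet> g x) *\<^sub>R D v)"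
  have "(?Z has_derivative ?D) (at x within S2)"
    by (auto intro!: derivative_eq_intros u W g[OF xV] simp: algebra_simps)
  then have "((\<lambda>y. cov_deriv \<sigma> y (W y)) has_derivative ?D) (at x within S2)"
    by (rule has_derivative_within_S2I[OF V x, rotated])
      (use WT cov_deriv_\<sigma> in \<open>auto simp: tproj_def u_def\<close>)
  from cov_deriv_eqI[OF this x e]
  have L: "cov_deriv (\<lambda>y. cov_deriv \<sigma> y (W y)) x e = tproj x (?D e)" .
  \<comment> \<open>The normal part of \<open>D e\<close> separates it from the covariant derivative
    of \<open>W\<close>; this difference, fed into \<open>H x\<close>, produces the
    \<open>H x x\<close> term of \<open>hess\<sigma>\<close>.\<close>
  have n: "x \<bullet> D e = - (W x \<bullet> e)" by (rule tangent_field_derivative_normal[OF W x WT e])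
  have cW: "cov_deriv W x e = D e + (W x \<bullet> e) *\<^sub>R x"
    using n by (simp add: cov_deriv_eqI[OF W x e] tproj_def)
  have HcW: "H x (D e + (W x \<bullet> e) *\<^sub>R x) = H x (D e) + (W x \<bullet> e) *\<^sub>R H x x"
    using linear_H[OF xV] by (simp add: linear_add linear_scale)
  have "cov_deriv W x e \<in> tangent_plane x"
    using tproj_tangent[OF x] unfolding cov_deriv_def by blast
  then have R: "cov_deriv \<sigma> x (cov_deriv W x e)
      = tproj x (H x (D e) + (W x \<bullet> e) *\<^sub>R H x x) - (x \<bullet> g x) *\<^sub>R (D e + (W x \<bullet> e) *\<^sub>R x)"
    using cov_deriv_\<sigma>[OF xV] by (simp only: cW HcW)
  have "x \<bullet> x = 1" "x \<bullet> e = 0" "x \<bullet> W x = 0"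
    using x e WT S2_inner_self by (auto simp: tangent_plane_def)
  then show ?thesis
    unfolding L R hess\<sigma>_def tproj_def u_def
    by (simp add: inner_add_right inner_diff_right n algebra_simps)
qed

text \<open>Frames at different points are unrelated choices; \<open>frame_trace\<close> gives a
  form that can be differentiated in \<open>y\<close>. The factor 2 is the trace of the identity on
  the tangent plane.\<close>

lemma laplacian_f:
  assumes y: "y \<in> V \<inter> S2"
  shows "laplacian f y = - ((\<Sum>b\<in>Basis. H y b \<bullet> b) - H y y \<bullet> y - 2 * (y \<bullet> g y))"
proof -
  have yS: "y \<in> S2" using y by simp
  have "cov_deriv (grad f) y e \<bullet> e = H y e \<bullet> e - (y \<bullet> g y) * (e \<bullet> e)" if "e \<in> frame y" for e
  proof -
    have "cov_deriv (grad f) y e = cov_deriv \<sigma> y e"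
      using \<sigma> by (intro cov_deriv_cong[OF open_UNIV UNIV_I yS]) simp
    then show ?thesis
      using cov_deriv_\<sigma>[OF y frame_tangent[OF that]] tproj_inner[OF frame_tangent[OF that]]
      by (simp add: inner_diff_left)
  qed
  then have "divergence (grad f) y
      = (\<Sum>e\<in>frame y. H y e \<bullet> e) - (y \<bullet> g y) * (\<Sum>e\<in>frame y. e \<bullet> e)"
    by (simp add: divergence_def sum_subtractf sum_distrib_left)
  then show ?thesis
    using frame_trace[OF yS linear_H[OF y]] frame_sum_self[OF yS] by (simp add: laplacian_def)
qed

end

section \<open>Bochner identities from the eigenvalue equation\<close>

locale eigen_jet = gradient_jet +
  fixes lam :: real
  assumes eigen: "y \<in> S2 \<Longrightarrow> laplacian f y = lam * f y"
begin

text \<open>The derivative of the eigenvalue equation.\<close>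

lemma trace_T:
  assumes v: "v \<in> tangent_plane x"
  shows "(\<Sum>e\<in>frame x. T v e \<bullet> e) = 4 * (H x x \<bullet> v) + (2 - lam) * (\<sigma> x \<bullet> v)"
proof -
  \<comment> \<open>By \<open>laplacian_f\<close> and the eigenvalue equation, \<open>?F\<close> is
    \<open>- lam * f\<close> near \<open>x\<close>; its derivative is computed from both expressions
    and compared. The term \<open>H y y\<close> is a sum over \<open>Basis\<close> because
    \<open>y\<close> is point and argument at once.\<close>
  let ?F = "\<lambda>y. (\<Sum>b\<in>Basis. H y b \<bullet> b) - y \<bullet> (\<Sum>b\<in>Basis. (y \<bullet> b) *\<^sub>R H y b) - 2 * (y \<bullet> g y)"
  have HH: "(\<Sum>b\<in>Basis. (w \<bullet> b) *\<^sub>R H y b) = H y w" if "y \<in> V \<inter> S2" for y w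
    by (rule linear_basis_expand[OF linear_H[OF that], symmetric])
  have TT: "(\<Sum>b\<in>Basis. (w \<bullet> b) *\<^sub>R T v b) = T v w" for w
    by (rule linear_basis_expand[OF linear_T, symmetric])
  have "(?F has_derivative (\<lambda>v. (\<Sum>b\<in>Basis. T b v \<bullet> b)
      - (x \<bullet> (\<Sum>b\<in>Basis. (x \<bullet> b) *\<^sub>R T b v + (v \<bullet> b) *\<^sub>R H x b)
        + v \<bullet> (\<Sum>b\<in>Basis. (x \<bullet> b) *\<^sub>R H x b))
      - 2 * (x \<bullet> H x v + v \<bullet> g x))) (at x within S2)"
    by (intro has_derivative_sum has_derivative_scaleR has_derivative_inner_left
      has_derivative_inner has_derivative_diff has_derivative_mult_right has_derivative_ident H
      g[OF xV])
  from differential_eqI[OF this x v]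
  have "differential ?F x v = (\<Sum>b\<in>Basis. T v b \<bullet> b) - (x \<bullet> (T x v + H x v) + v \<bullet> H x x)
      - 2 * (x \<bullet> H x v + v \<bullet> g x)"
    by (simp add: sum.distrib TT HH[OF xV] T_swap[of _ v])
  moreover have "(?F has_derivative (\<lambda>w. - lam * (g x \<bullet> w))) (at x within S2)"
  proof (rule has_derivative_within_S2I[OF V x])
    show "?F y = - lam * f y" if "y \<in> V \<inter> S2" for y
      using laplacian_f[OF that] eigen[of y] that HH[OF that, of y] by (simp add: inner_commute)
    show "((\<lambda>y. - lam * f y) has_derivative (\<lambda>w. - lam * (g x \<bullet> w))) (at x within S2)"
      by (intro has_derivative_mult_right f[OF xV])
  qed
  then have "differential ?F x v = - lam * (g x \<bullet> v)" by (rule differential_eqI[OF _ x v])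
  moreover have "\<sigma> x \<bullet> v = g x \<bullet> v" using \<sigma>_eq[OF xV] tproj_inner[OF v] by simp
  moreover have "(\<Sum>e\<in>frame x. T v e \<bullet> e) = (\<Sum>b\<in>Basis. T v b \<bullet> b) - T v x \<bullet> x"
    by (rule frame_trace[OF x linear_T])
  moreover have "x \<bullet> H x v = H x x \<bullet> v" using H_sym[OF xV, of x v] by (simp add: inner_commute)
  ultimately show ?thesis
    by (simp add: inner_add_right inner_commute T_swap[of v] algebra_simps)
qed

lemma cov_deriv_\<sigma>_0: "cov_deriv \<sigma> x 0 = 0"
  using cov_deriv_\<sigma>[OF xV, of 0] linear_0[OF linear_H[OF xV]]
  by (simp add: tproj_def tangent_plane_def)

lemma hess\<sigma>_inner:
  assumes "v \<in> tangent_plane x"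
  shows "hess\<sigma> w e \<bullet> v = T w e \<bullet> v - (w \<bullet> e) * (H x x \<bullet> v) - (H x x \<bullet> w) * (e \<bullet> v)
    - (g x \<bullet> e + H x x \<bullet> e) * (w \<bullet> v)"
  using H_sym[OF xV, of x w] H_sym[OF xV, of x e]
  by (simp add: hess\<sigma>_def inner_diff_left tproj_inner[OF assms] inner_commute[of x]
    inner_commute[of e "g x"])

text \<open>Bochner's formula for a gradient: the shift by 1 is the Ricci curvature of the unit
  sphere. In the trace, the \<open>H x x\<close> terms of \<open>hess\<sigma>\<close> cancel those
  of \<open>trace_T\<close>, and the coefficient \<open>2 - lam\<close> loses 1 to the
  \<open>g x\<close> term.\<close>

lemma rough_laplacian_\<sigma>: "rough_laplacian \<sigma> x = (lam - 1) *\<^sub>R \<sigma> x"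
proof -
  have n: "nabla2 (\<lambda>y. tproj y e) (\<lambda>y. tproj y e) \<sigma> x = hess\<sigma> e e" if "e \<in> frame x" for e
  proof -
    have e: "e \<in> tangent_plane x" using frame_tangent[OF that] .
    show ?thesis
      using cov_deriv_nabla[OF tproj_field(1)[OF x e] tproj_tangent e]
      by (simp add: nabla2_def nabla_def[abs_def] tproj_id[OF e] tproj_field(2)[OF x e]
        cov_deriv_\<sigma>_0)
  qed
  have "(\<Sum>e\<in>frame x. hess\<sigma> e e) = (1 - lam) *\<^sub>R \<sigma> x"
  proof (rule tangent_plane_eqI)
    have "hess\<sigma> e e \<in> tangent_plane x" if "e \<in> frame x" for e
      using frame_tangent[OF that] tproj_tangent[OF x]
      by (simp add: hess\<sigma>_def tangent_plane_def inner_diff_right)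
    then show "(\<Sum>e\<in>frame x. hess\<sigma> e e) \<in> tangent_plane x"
      by (simp add: tangent_plane_def inner_sum_right)
    show "(1 - lam) *\<^sub>R \<sigma> x \<in> tangent_plane x"
      using \<sigma>_tangent[OF x] by (simp add: tangent_plane_def)
    fix v assume v: "v \<in> tangent_plane x"
    have "(\<Sum>e\<in>frame x. hess\<sigma> e e) \<bullet> v = (\<Sum>e\<in>frame x. T v e \<bullet> e) - (\<Sum>e\<in>frame x. e \<bullet> e) * (H x x \<bullet> v)
        - 2 * (\<Sum>e\<in>frame x. (H x x \<bullet> e) * (v \<bullet> e)) - (\<Sum>e\<in>frame x. (g x \<bullet> e) * (v \<bullet> e))"
    proof -
      have "hess\<sigma> e e \<bullet> v = T v e \<bullet> e - (e \<bullet> e) * (H x x \<bullet> v)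
          - 2 * ((H x x \<bullet> e) * (v \<bullet> e)) - (g x \<bullet> e) * (v \<bullet> e)" for e
        using T_sym(2)[of e e v] T_swap[of e v] inner_commute[of e v]
        by (simp add: hess\<sigma>_inner[OF v] algebra_simps)
      then show ?thesis
        by (simp only: inner_sum_left sum_subtractf sum_distrib_left sum_distrib_right)
    qed
    also have "\<dots> = (1 - lam) *\<^sub>R \<sigma> x \<bullet> v"
      unfolding trace_T[OF v] frame_sum_self[OF x] frame_inner_sum[OF x v]
      using \<sigma>_eq[OF xV] tproj_inner[OF v] by (simp add: algebra_simps)
    finally show "(\<Sum>e\<in>frame x. hess\<sigma> e e) \<bullet> v = (1 - lam) *\<^sub>R \<sigma> x \<bullet> v" .
  qed
  then show ?thesis by (simp add: rough_laplacian_def n algebra_simps)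
qed

text \<open>Metric compatibility gives the derivative along \<open>v\<close> as
  \<open>cov_deriv \<sigma> y v \<bullet> \<sigma> y\<close>, and symmetry of the Hessian exchanges
  \<open>v\<close> and \<open>\<sigma> y\<close>. It is proved near \<open>x\<close>, not only at
  \<open>x\<close>, because the gradient is differentiated again.\<close>

lemma grad_half_norm_sq:
  assumes y: "y \<in> V \<inter> S2"
  shows "grad (half_norm_sq \<sigma>) y = cov_deriv \<sigma> y (\<sigma> y)"
proof -
  obtain D where D: "(\<sigma> has_derivative D) (at y within S2)" using \<sigma>_derivative[OF y] by blast
  have yS: "y \<in> S2" using y by simp
  have "((\<lambda>y. (\<sigma> y \<bullet> \<sigma> y) / 2) has_derivative (\<lambda>v. \<sigma> y \<bullet> D v)) (at y within S2)"
    by (auto intro!: derivative_eq_intros D simp: inner_commute)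
  then have h: "(half_norm_sq \<sigma> has_derivative (\<lambda>v. \<sigma> y \<bullet> D v)) (at y within S2)"
    by (simp add: half_norm_sq_def[abs_def] dot_square_norm)
  note gr = grad[OF differentiableI[OF h] _ yS]
  show ?thesis
  proof (rule tangent_plane_eqI)
    show "grad (half_norm_sq \<sigma>) y \<in> tangent_plane y"
      using gr(1)[of 0] by (simp add: tangent_plane_def)
    show "cov_deriv \<sigma> y (\<sigma> y) \<in> tangent_plane y"
      by (rule cov_deriv_\<sigma>_tangent[OF y \<sigma>_tangent[OF yS]])
    fix v assume v: "v \<in> tangent_plane y"
    have "grad (half_norm_sq \<sigma>) y \<bullet> v = D v \<bullet> \<sigma> y"
      using gr(2)[OF v] differential_eqI[OF h yS v] by (simp add: inner_commute)
    also have "\<dots> = cov_deriv \<sigma> y v \<bullet> \<sigma> y"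
      by (simp add: cov_deriv_eqI[OF D yS v] tproj_inner[OF \<sigma>_tangent[OF yS]])
    finally show "grad (half_norm_sq \<sigma>) y \<bullet> v = cov_deriv \<sigma> y (\<sigma> y) \<bullet> v"
      using cov_deriv_\<sigma>_sym[OF y v \<sigma>_tangent[OF yS]] by simp
  qed
qed

text \<open>Differentiating \<open>cov_deriv \<sigma> y (\<sigma> y)\<close> once more yields a
  trace of \<open>hess\<sigma>\<close>, evaluated by \<open>trace_T\<close>, and the trace of the
  square of \<open>\<nabla>\<sigma>\<close>, which is its squared norm by self-adjointness.\<close>

lemma laplacian_half_norm_sq:
  "laplacian (half_norm_sq \<sigma>) x = (lam - 1) * (norm (\<sigma> x))\<^sup>2 - norm_nabla_sq \<sigma> x"
proof -
  let ?A = "cov_deriv \<sigma> x"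
  note s = \<sigma>_tangent[OF x]
  have "cov_deriv (grad (half_norm_sq \<sigma>)) x e \<bullet> e = hess\<sigma> (\<sigma> x) e \<bullet> e + (norm (?A e))\<^sup>2"
    if "e \<in> frame x" for e
  proof -
    have e: "e \<in> tangent_plane x" using frame_tangent[OF that] .
    have "cov_deriv (grad (half_norm_sq \<sigma>)) x e = cov_deriv (\<lambda>y. cov_deriv \<sigma> y (\<sigma> y)) x e"
      using grad_half_norm_sq by (rule cov_deriv_cong[OF V x])
    also have "\<dots> = hess\<sigma> (\<sigma> x) e + ?A (?A e)"
      by (rule cov_deriv_nabla[OF \<sigma>_derivative[OF xV] \<sigma>_tangent e])
    finally show ?thesis
      using cov_deriv_\<sigma>_sym[OF xV cov_deriv_\<sigma>_tangent[OF xV e] e]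
      by (simp add: inner_add_left dot_square_norm)
  qed
  then have "laplacian (half_norm_sq \<sigma>) x
      = - (\<Sum>e\<in>frame x. hess\<sigma> (\<sigma> x) e \<bullet> e) - norm_nabla_sq \<sigma> x"
    by (simp add: laplacian_def divergence_def norm_nabla_sq_def sum.distrib)
  also have "(\<Sum>e\<in>frame x. hess\<sigma> (\<sigma> x) e \<bullet> e) = (\<Sum>e\<in>frame x. T (\<sigma> x) e \<bullet> e)
      - (\<Sum>e\<in>frame x. (H x x \<bullet> e) * (\<sigma> x \<bullet> e)) - (H x x \<bullet> \<sigma> x) * (\<Sum>e\<in>frame x. e \<bullet> e)
      - (\<Sum>e\<in>frame x. (g x \<bullet> e) * (\<sigma> x \<bullet> e)) - (\<Sum>e\<in>frame x. (H x x \<bullet> e) * (\<sigma> x \<bullet> e))"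
    by (simp add: hess\<sigma>_inner[OF frame_tangent] sum_subtractf sum.distrib sum_distrib_left
      algebra_simps)
  also have "\<dots> = (1 - lam) * (\<sigma> x \<bullet> \<sigma> x)"
    unfolding trace_T[OF s] frame_sum_self[OF x] frame_inner_sum[OF x s]
    using tproj_inner[OF s, of "g x"] \<sigma>_eq[OF xV] by (simp add: algebra_simps)
  finally show ?thesis by (simp add: dot_square_norm algebra_simps)
qed

lemma trace_cov_deriv: "(\<Sum>e\<in>frame x. cov_deriv \<sigma> x e \<bullet> e) = - lam * f x"
proof -
  have "cov_deriv (grad f) x e = cov_deriv \<sigma> x e" for e
    using \<sigma> by (intro cov_deriv_cong[OF open_UNIV UNIV_I x]) simp
  then show ?thesis using eigen[OF x] by (simp add: laplacian_def divergence_def)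
qed

lemma trace_cov_deriv_eq_0:
  assumes "cov_deriv \<sigma> x (cov_deriv \<sigma> x (\<sigma> x)) = \<mu> *\<^sub>R \<sigma> x"
    and "cov_deriv \<sigma> x (\<sigma> x) \<noteq> \<sigma> x" "independent {cov_deriv \<sigma> x (\<sigma> x), \<sigma> x}"
  shows "lam * f x = 0"
proof -
  have sc: "u \<in> tangent_plane x \<Longrightarrow> c *\<^sub>R u \<in> tangent_plane x"
    "u \<in> tangent_plane x \<Longrightarrow> v \<in> tangent_plane x \<Longrightarrow> u + v \<in> tangent_plane x" for u v c
    by (simp_all add: tangent_plane_def inner_add_right)
  have "(\<Sum>e\<in>frame x. cov_deriv \<sigma> x e \<bullet> e) = 0"
  proof (rule trace_eq_0_of_square_parallel[OF x cov_deriv_\<sigma>_tangent[OF xV] _ _ \<sigma>_tangent[OF x]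
        assms])
    fix u v c assume u: "u \<in> tangent_plane x"
    then show "cov_deriv \<sigma> x (c *\<^sub>R u) = c *\<^sub>R cov_deriv \<sigma> x u"
      by (simp add: cov_deriv_\<sigma>[OF xV] sc linear_scale[OF linear_H[OF xV]] tproj_def algebra_simps)
    assume v: "v \<in> tangent_plane x"
    show "cov_deriv \<sigma> x (u + v) = cov_deriv \<sigma> x u + cov_deriv \<sigma> x v"
      using u v
      by (simp add: cov_deriv_\<sigma>[OF xV] sc linear_add[OF linear_H[OF xV]] tproj_def inner_add_right
        algebra_simps)
  qed
  then show ?thesis using trace_cov_deriv by simp
qed

end

section \<open>The sign of the Laplacian, by cases in \<open>lam\<close> and
  \<open>p\<close>\<close>

theorem proposition4p1:
  fixes p q lam :: real
    and f :: "real^3 \<Rightarrow> real"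
    and \<sigma> :: "real^3 \<Rightarrow> real^3"
    and U :: "(real^3) set"
  assumes "q \<ge> 0"
    and "pq_harmonic p q \<sigma>"
    and "\<exists>x\<in>S2. \<sigma> x \<noteq> 0"
    and "smooth_S2 f"
    and "\<forall>x\<in>S2. \<sigma> x = grad f x"
    and "\<forall>x\<in>S2. laplacian f x = lam * f x"
    and "openin (top_of_set S2) U"
    and "\<forall>x\<in>U. nabla \<sigma> \<sigma> x \<noteq> \<sigma> x \<and> independent {nabla \<sigma> \<sigma> x, \<sigma> x}"
  shows "\<forall>x\<in>U. laplacian (half_norm_sq \<sigma>) x \<le> 0"
proof
  have jet: "\<exists>V g H T. eigen_jet V x f g H T \<sigma> lam" if xS: "x \<in> S2" for x
  proof -
    obtain V g H T where "ambient_jet V x f g H T"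
      using smooth_S2_ambient_jet[OF assms(4) xS] .
    then have "eigen_jet V x f g H T \<sigma> lam"
      using assms(2,5,6)
      by (simp add: pq_harmonic_def vector_field_def eigen_jet_def gradient_jet_def
        gradient_jet_axioms_def eigen_jet_axioms_def)
    then show ?thesis by blast
  qed
  obtain W where W: "open W" "U = S2 \<inter> W" using assms(7) by (auto simp: openin_open)
  fix x assume xU: "x \<in> U"
  then have x: "x \<in> S2" "x \<in> W" using W by auto
  let ?L = "laplacian (half_norm_sq \<sigma>)"
  have L: "?L y = (lam - 1) * (norm (\<sigma> y))\<^sup>2 - norm_nabla_sq \<sigma> y" if "y \<in> S2" for y
    using jet[OF that] eigen_jet.laplacian_half_norm_sq by blast
  have nn: "norm_nabla_sq \<sigma> y \<ge> 0" for y by (simp add: norm_nabla_sq_def sum_nonneg)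
  \<comment> \<open>The harmonicity equation after inserting the rough Laplacian and the gradient:
    its second term is now the square of \<open>\<nabla>\<sigma>\<close> applied to
    \<open>\<sigma>\<close>.\<close>
  have eq: "((1 + (norm (\<sigma> y))\<^sup>2) * (lam - 1)) *\<^sub>R \<sigma> y
        + (2 * p) *\<^sub>R cov_deriv \<sigma> y (cov_deriv \<sigma> y (\<sigma> y))
      = (p * norm_nabla_sq \<sigma> y - p * q * (norm (grad (half_norm_sq \<sigma>) y))\<^sup>2
         - q * (1 + (norm (\<sigma> y))\<^sup>2) * ?L y) *\<^sub>R \<sigma> y" (is "_ = ?c y *\<^sub>R _") if yS: "y \<in> S2" for y
  proof -
    obtain V g H T where "eigen_jet V y f g H T \<sigma> lam" using jet[OF yS] by blast
    then interpret eigen_jet V y f g H T \<sigma> lam .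
    show ?thesis
      using bspec[OF conjunct2[OF assms(2)[unfolded pq_harmonic_def]] yS]
      unfolding rough_laplacian_\<sigma> nabla_def grad_half_norm_sq[OF xV] scaleR_scaleR .
  qed
  have ind: "cov_deriv \<sigma> y (\<sigma> y) \<noteq> \<sigma> y" "independent {cov_deriv \<sigma> y (\<sigma> y), \<sigma> y}" if "y \<in> U" for y
    using assms(8) that by (auto simp: nabla_def)
  have nz: "\<sigma> x \<noteq> 0" using ind(2)[OF xU] dependent_zero by (metis insertI1 insertI2)
  show "?L x \<le> 0"
  proof (cases "lam \<le> 1")
    case True
    then have "(lam - 1) * (norm (\<sigma> x))\<^sup>2 \<le> 0" by (simp add: mult_nonpos_nonneg)
    then show ?thesis using L[OF x(1)] nn[of x] by simp
  next
    case False
    have "p = 0"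
    proof (rule ccontr)
      assume p: "p \<noteq> 0"
      have f0: "f y = 0" if y: "y \<in> U" for y
      proof -
        have yS: "y \<in> S2" using y W by simp
        \<comment> \<open>The equation solved for \<open>?B\<close>, which is possible since
          \<open>p\<close> is nonzero.\<close>
        define m where "m = (?c y - (1 + (norm (\<sigma> y))\<^sup>2) * (lam - 1)) / (2 * p)"
        let ?B = "cov_deriv \<sigma> y (cov_deriv \<sigma> y (\<sigma> y))"
        have "(2 * p) *\<^sub>R ?B = (?c y - (1 + (norm (\<sigma> y))\<^sup>2) * (lam - 1)) *\<^sub>R \<sigma> y"
          unfolding scaleR_diff_left[of "?c y"] using eq[OF yS] by (simp add: algebra_simps)
        also have "\<dots> = (2 * p) *\<^sub>R m *\<^sub>R \<sigma> y" using p by (simp add: m_def)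
        finally have "?B = m *\<^sub>R \<sigma> y" using p by (simp del: scaleR_scaleR)
        then have "lam * f y = 0"
          using jet[OF yS] eigen_jet.trace_cov_deriv_eq_0 ind[OF y] by blast
        then show ?thesis using False by simp
      qed
      \<comment> \<open>Since \<open>U\<close> is relatively open, vanishing of \<open>f\<close> on
        \<open>U\<close> kills its derivative at \<open>x\<close>, hence its gradient
        \<open>\<sigma> x\<close>.\<close>
      have D: "(f has_derivative (\<lambda>v. 0)) (at x within S2)"
        by (rule has_derivative_within_S2I[OF W(1) x(2,1), of f "\<lambda>_. 0"]) (use f0 W in auto)
      note gr = grad[OF differentiableI[OF D] _ x(1)]
      have "\<sigma> x \<in> tangent_plane x"
        using gr(1)[of 0] assms(5) x by (simp add: tangent_plane_def)
      then have "\<sigma> x \<bullet> \<sigma> x = 0"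
        using gr(2) differential_eqI[OF D x(1)] assms(5) x by simp
      then show False using nz by simp
    qed
    then have "((1 + (norm (\<sigma> x))\<^sup>2) * (lam - 1)) *\<^sub>R \<sigma> x
        = (- q * (1 + (norm (\<sigma> x))\<^sup>2) * ?L x) *\<^sub>R \<sigma> x"
      using eq[OF x(1)] by simp
    then have "(1 + (norm (\<sigma> x))\<^sup>2) * (lam - 1) = (1 + (norm (\<sigma> x))\<^sup>2) * (- q * ?L x)"
      using nz unfolding scaleR_cancel_right by simp
    moreover have "1 + (norm (\<sigma> x))\<^sup>2 \<noteq> 0" by (smt (verit) zero_le_power2)
    \<comment> \<open>The left side is positive in this case, so with \<open>q\<close> nonnegative
      \<open>?L x\<close> cannot be positive.\<close>
    ultimately have "lam - 1 = - q * ?L x" by (simp only: mult_cancel_left) simp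
    then show ?thesis using False assms(1) by (smt (verit) mult_nonneg_nonneg mult_minus_left)
  qed
qed

end
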